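(* For each critical poset $\mathcal S$ and each pair $\lambda\neq\mu$ of complex numbers, the subspace representations $\mathcal V_\lambda(\mathcal S)$ and $\mathcal V_\mu(\mathcal S)$ are not equivalent. Moreover, for each critical poset $\mathcal S$, the subspace representation $\mathcal V(\mathcal S_a)$ is schurian.
   Context: A subspace representation of a finite poset $\mathcal P$ is a tuple $(V;V_i)_{i\in\mathcal P}$ of a finite-dimensional complex space $V$ and subspaces with $V_i\subseteq V_j$ whenever $i\prec j$; two such are equivalent if a linear bijection $g$ between the spaces satisfies $g(V_i)=W_i$ for all $i$. It is schurian if $\{g\in\mathrm{End}(V): g(V_i)\subseteq V_i\ \forall i\}=\mathbb C\cdot\mathrm{id}$. The poset $(t_1,\dots,t_s)$ is the disjoint union of incomparable chains of sizes $t_i$; $N$ has elements $a_1,a_2,b_1,b_2$ with exactly $a_1\prec b_1,a_2\prec b_1,a_2\prec b_2$; $(N,4)$ is the disjoint union of $N$ and a 4-chain. The critical posets are $(1,1,1,1),(2,2,2),(1,3,3),(1,2,5),(N,4)$. Let $e_i$ be the standard basis vectors of $\mathbb C^n$, $e_{i_1\dots i_k}=e_{i_1}+\dots+e_{i_k}$, and $\langle\cdots\rangle$ the span. For $\lambda\in\mathbb C$ define $\mathcal V_\lambda(\mathcal S)$ as follows (chains listed bottom to top): $(1,1,1,1)$: $V=\mathbb C^2$, subspaces $\langle e_1\rangle,\langle e_2\rangle,\langle e_1+e_2\rangle,\langle e_1+\lambda e_2\rangle$. $(2,2,2)$: $V=\mathbb C^3$, chains $\langle e_{123}\rangle\subset\langle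 e_{123},e_1+\lambda e_3\rangle$; $\langle e_1\rangle\subset\langle e_1,e_2\rangle$; $\langle e_3\rangle\subset\langle e_2,e_3\rangle$. $(1,3,3)$: $V=\mathbb C^4$, single element $\langle e_{123},e_{24}\rangle$; chains $\langle e_4\rangle\subset\langle e_1,e_4\rangle\subset\langle e_1,e_4,e_2+\lambda e_3\rangle$; $\langle e_3\rangle\subset\langle e_2,e_3\rangle\subset\langle e_1,e_2,e_3\rangle$. $(1,2,5)$: $V=\mathbb C^6$, single element $\langle e_{123},e_{245},e_{16}\rangle$; chain $\langle e_5,e_6\rangle\subset\langle e_1,e_2,e_5,e_6\rangle$; chain $\langle e_4\rangle\subset\langle e_3,e_4\rangle\subset\langle e_2,e_3,e_4\rangle\subset\langle e_1,e_2,e_3,e_4\rangle\subset\langle e_1,e_2,e_3,e_4,e_5+\lambda e_6\rangle$. $(N,4)$: $V=\mathbb C^5$, 4-chain $\langle e_4\rangle\subset\langle e_3,e_4\rangle\subset\langle e_2,e_3,e_4\rangle\subset\langle e_1,e_2,e_3,e_4\rangle$; on $N$: $a_1\mapsto\langle e_{235},e_{134}\rangle$, $a_2\mapsto\langle e_5\rangle$, $b_1\mapsto\langle e_{235},e_{134},e_5,e_3+\lambda e_4\rangle$, $b_2\mapsto\langle e_1,e_2,e_5\rangle$. In each case let $a\in\mathcal S$ be the unique element whose subspace depends on $\lambda$, $\mathcal S_a=\mathcal S\setminus\{a\}$ (with induced order), and $\mathcal V(\mathcal S_a)$ the subspace representation of $\mathcal S_a$ obtained from $\mathcal V_\lambda(\mathcal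 S)$ by deleting the subspace at $a$. *)

theory Defs
  imports "HOL-Analysis.Analysis" "HOL-Library.Numeral_Type"
begin

section \<open>Subspace representations over the complex numbers\<close>

text \<open>The ambient space C^n is complex^'n (with 'n a numeral type of cardinality n);
  subspaces are complex spans (vec.span for the scalar multiplication *s).
  Poset elements are labelled by natural numbers; a representation is a map from
  labels to subspaces, considered on a finite carrier set of labels.\<close>

definition cspan :: "('a::field ^ 'n) set \<Rightarrow> ('a ^ 'n) set" where
  "cspan S = vec.span S"

text \<open>Standard basis vector e_i (1-based, as in the paper).\<close>
definition ee :: "nat \<Rightarrow> complex ^ 'n::{finite,comm_ring_1}" where
  "ee i = axis (of_nat (i - 1)) 1"

text \<open>Two subspace representations V, W (of the poset with carrier P) in the same space
  are equivalent iff some linear bijection g maps V i onto W i for all i.\<close>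
definition rep_equivalent ::
  "nat set \<Rightarrow> (nat \<Rightarrow> (complex ^ 'n) set) \<Rightarrow> (nat \<Rightarrow> (complex ^ 'n) set) \<Rightarrow> bool" where
  "rep_equivalent P V W \<longleftrightarrow>
     (\<exists>g. Vector_Spaces.linear (*s) (*s) g \<and> bij g \<and> (\<forall>i\<in>P. g ` V i = W i))"

text \<open>Schurian: the endomorphisms preserving all subspaces are exactly the scalars.\<close>
definition schurian :: "nat set \<Rightarrow> (nat \<Rightarrow> (complex ^ 'n) set) \<Rightarrow> bool" where
  "schurian P V \<longleftrightarrow>
     {g. Vector_Spaces.linear (*s) (*s) g \<and> (\<forall>i\<in>P. g ` V i \<subseteq> V i)}
       = {g. \<exists>c::complex. g = (\<lambda>x. c *s x)}"

section \<open>The critical posets and the representations V_lambda\<close>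

text \<open>(1,1,1,1): elements 1,2,3,4 (pairwise incomparable); a = 4.\<close>
definition P1111 :: "nat set" where "P1111 = {1,2,3,4}"
definition ord1111 :: "nat rel" where "ord1111 = {}"
definition V1111 :: "complex \<Rightarrow> nat \<Rightarrow> (complex ^ 2) set" where
  "V1111 l i = (if i = 1 then cspan {ee 1}
    else if i = 2 then cspan {ee 2}
    else if i = 3 then cspan {ee 1 + ee 2}
    else if i = 4 then cspan {ee 1 + l *s ee 2}
    else {})"
definition a1111 :: nat where "a1111 = 4"

text \<open>(2,2,2): chains 1<2, 3<4, 5<6; a = 2.\<close>
definition P222 :: "nat set" where "P222 = {1,2,3,4,5,6}"
definition ord222 :: "nat rel" where "ord222 = {(1,2),(3,4),(5,6)}"
definition V222 :: "complex \<Rightarrow> nat \<Rightarrow> (complex ^ 3) set" where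
  "V222 l i = (if i = 1 then cspan {ee 1 + ee 2 + ee 3}
    else if i = 2 then cspan {ee 1 + ee 2 + ee 3, ee 1 + l *s ee 3}
    else if i = 3 then cspan {ee 1}
    else if i = 4 then cspan {ee 1, ee 2}
    else if i = 5 then cspan {ee 3}
    else if i = 6 then cspan {ee 2, ee 3}
    else {})"
definition a222 :: nat where "a222 = 2"

text \<open>(1,3,3): single element 1; chains 2<3<4 and 5<6<7; a = 4.\<close>
definition P133 :: "nat set" where "P133 = {1,2,3,4,5,6,7}"
definition ord133 :: "nat rel" where "ord133 = {(2,3),(3,4),(2,4),(5,6),(6,7),(5,7)}"
definition V133 :: "complex \<Rightarrow> nat \<Rightarrow> (complex ^ 4) set" where
  "V133 l i = (if i = 1 then cspan {ee 1 + ee 2 + ee 3, ee 2 + ee 4}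
    else if i = 2 then cspan {ee 4}
    else if i = 3 then cspan {ee 1, ee 4}
    else if i = 4 then cspan {ee 1, ee 4, ee 2 + l *s ee 3}
    else if i = 5 then cspan {ee 3}
    else if i = 6 then cspan {ee 2, ee 3}
    else if i = 7 then cspan {ee 1, ee 2, ee 3}
    else {})"
definition a133 :: nat where "a133 = 4"

text \<open>(1,2,5): single element 1; chain 2<3; chain 4<5<6<7<8; a = 8.\<close>
definition P125 :: "nat set" where "P125 = {1,2,3,4,5,6,7,8}"
definition ord125 :: "nat rel" where
  "ord125 = {(2,3)} \<union> {(i,j). 4 \<le> i \<and> i < j \<and> j \<le> 8}"
definition V125 :: "complex \<Rightarrow> nat \<Rightarrow> (complex ^ 6) set" where
  "V125 l i = (if i = 1 then cspan {ee 1 + ee 2 + ee 3, ee 2 + ee 4 + ee 5, ee 1 + ee 6}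
    else if i = 2 then cspan {ee 5, ee 6}
    else if i = 3 then cspan {ee 1, ee 2, ee 5, ee 6}
    else if i = 4 then cspan {ee 4}
    else if i = 5 then cspan {ee 3, ee 4}
    else if i = 6 then cspan {ee 2, ee 3, ee 4}
    else if i = 7 then cspan {ee 1, ee 2, ee 3, ee 4}
    else if i = 8 then cspan {ee 1, ee 2, ee 3, ee 4, ee 5 + l *s ee 6}
    else {})"
definition a125 :: nat where "a125 = 8"

text \<open>(N,4): 4-chain 1<2<3<4; N with a_1 = 5, a_2 = 6, b_1 = 7, b_2 = 8,
  a_1<b_1, a_2<b_1, a_2<b_2; the lambda-dependent element is b_1 = 7.\<close>
definition PN4 :: "nat set" where "PN4 = {1,2,3,4,5,6,7,8}"
definition ordN4 :: "nat rel" where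
  "ordN4 = {(i,j). 1 \<le> i \<and> i < j \<and> j \<le> 4} \<union> {(5,7),(6,7),(6,8)}"
definition VN4 :: "complex \<Rightarrow> nat \<Rightarrow> (complex ^ 5) set" where
  "VN4 l i = (if i = 1 then cspan {ee 4}
    else if i = 2 then cspan {ee 3, ee 4}
    else if i = 3 then cspan {ee 2, ee 3, ee 4}
    else if i = 4 then cspan {ee 1, ee 2, ee 3, ee 4}
    else if i = 5 then cspan {ee 2 + ee 3 + ee 5, ee 1 + ee 3 + ee 4}
    else if i = 6 then cspan {ee 5}
    else if i = 7 then cspan {ee 2 + ee 3 + ee 5, ee 1 + ee 3 + ee 4, ee 5, ee 3 + l *s ee 4}
    else if i = 8 then cspan {ee 1, ee 2, ee 5}
    else {})"
definition aN4 :: nat where "aN4 = 7"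

end

(* An endomorphism g of V(S_a) preserves the coordinate subspaces <e_i : i in I> occurring
   in the chains; intersecting them confines each g(e_i) to the span of very few e_j, mostly
   to the line <e_i>. Invariance of the remaining subspaces, spanned by sums of the e_i, then
   kills the off-diagonal coefficients and equates the diagonal ones, so g is a scalar.
   Since V_lambda(S) and V_mu(S) coincide off a, an equivalence between them is an
   endomorphism of V(S_a), hence a nonzero scalar; scalars fix every subspace, whereas the
   subspace at a determines lambda. *)

theory Submission
  imports Defs
begin

lemma UNIV_eq_of_nat_lessThan_CARD:
  assumes "CHAR('n::{finite,comm_ring_1}) = CARD('n)"
  shows "(UNIV :: 'n set) = of_nat ` {..<CARD('n)}"
proof -
  have "inj_on (of_nat :: nat \<Rightarrow> 'n) {..<CARD('n)}"
  proof (rule linorder_inj_onI)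
    fix m n assume "m < n" "n \<in> {..<CARD('n)}"
    then show "(of_nat m :: 'n) \<noteq> of_nat n"
      using assms by (auto simp: of_nat_eq_iff_char_dvd dest: dvd_imp_le)
  qed auto
  then have "card (of_nat ` {..<CARD('n)} :: 'n set) = CARD('n)"
    by (simp add: card_image)
  then show ?thesis
    by (intro card_subset_eq[symmetric]) simp_all
qed

lemma all_of_nat_lessThan_CARD:
  assumes "CHAR('n::{finite,comm_ring_1}) = CARD('n)"
  shows "(\<forall>i::'n. P i) \<longleftrightarrow> (\<forall>k\<in>{..<CARD('n)}. P (of_nat k))"
proof (intro iffI allI)
  fix i :: 'n
  assume "\<forall>k\<in>{..<CARD('n)}. P (of_nat k)"
  moreover obtain k where "k \<in> {..<CARD('n)}" "i = of_nat k"
    using UNIV_eq_of_nat_lessThan_CARD[OF assms] by blast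
  ultimately show "P i" by simp
qed simp

lemma vec_eq_iff_of_nat:
  fixes v w :: "'a ^ 'n::{finite,comm_ring_1}"
  assumes "CHAR('n) = CARD('n)"
  shows "v = w \<longleftrightarrow> (\<forall>k\<in>{..<CARD('n)}. v $ of_nat k = w $ of_nat k)"
  by (simp only: vec_eq_iff all_of_nat_lessThan_CARD[OF assms])

lemma ee_nth: "(ee i :: complex ^ 'n::{finite,comm_ring_1}) $ j = (if j = of_nat (i - 1) then 1 else 0)"
  by (simp add: ee_def axis_def)

text \<open>On numeral types CHAR = CARD holds by simp, so these rules split an identity between
  combinations of the ee i into one scalar equation per coordinate.\<close>
lemmas ee_coordinate_simps = vec_eq_iff_of_nat ee_nth lessThan_nat_numeral

lemma mem_cspan_insert: "x \<in> cspan (insert a S) \<longleftrightarrow> (\<exists>k y. y \<in> cspan S \<and> x = k *s a + y)"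
proof -
  have "x - k *s a \<in> cspan S \<longleftrightarrow> (\<exists>y. y \<in> cspan S \<and> x = k *s a + y)" for k
    by (auto simp: algebra_simps)
  then show ?thesis
    unfolding cspan_def vec.span_insert by simp
qed

lemma mem_cspan_empty: "x \<in> cspan {} \<longleftrightarrow> x = 0"
  unfolding cspan_def by simp

lemmas mem_cspan_iff = mem_cspan_insert mem_cspan_empty

lemma cspan_base: "x \<in> S \<Longrightarrow> x \<in> cspan S"
  unfolding cspan_def by (rule vec.span_base)

lemma subspace_cspan: "vec.subspace (cspan S)"
  unfolding cspan_def by (rule vec.subspace_span)

lemma scale_image_subspace:
  fixes U :: "('a::field ^ 'n) set"
  assumes "c \<noteq> 0" and "vec.subspace U"
  shows "(\<lambda>x. c *s x) ` U = U"
proof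
  show "(\<lambda>x. c *s x) ` U \<subseteq> U"
    using assms(2) by (auto intro: vec.subspace_scale)
  show "U \<subseteq> (\<lambda>x. c *s x) ` U"
  proof
    fix x assume "x \<in> U"
    then have "x = c *s (inverse c *s x)" "inverse c *s x \<in> U"
      using assms by (simp_all add: vec.subspace_scale)
    then show "x \<in> (\<lambda>x. c *s x) ` U" by blast
  qed
qed

lemma linear_eq_scale_if_axis_eigenvectors:
  fixes g :: "'a::field ^ 'n \<Rightarrow> 'a ^ 'n"
  assumes lin: "Vector_Spaces.linear (*s) (*s) g"
    and eigen: "\<forall>i. g (axis i 1) = c *s axis i 1"
  shows "g = (\<lambda>x. c *s x)"
proof
  fix x :: "'a ^ 'n"
  have "x \<in> vec.span cart_basis"
    by simp
  show "g x = c *s x"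
    by (rule vec.linear_eq_on_span[OF lin vec.linear_scale_self _ \<open>x \<in> vec.span cart_basis\<close>])
      (auto simp: cart_basis_def eigen)
qed

lemma schurianI:
  fixes V :: "nat \<Rightarrow> (complex ^ 'n) set"
  assumes "\<And>i. i \<in> P \<Longrightarrow> vec.subspace (V i)"
    and "\<And>g. Vector_Spaces.linear (*s) (*s) g
      \<Longrightarrow> (\<And>i v. i \<in> P \<Longrightarrow> v \<in> V i \<Longrightarrow> g v \<in> V i)
      \<Longrightarrow> \<exists>c. g = (\<lambda>x. c *s x)"
  shows "schurian P V"
  unfolding schurian_def
proof (intro set_eqI iffI)
  fix g :: "complex ^ 'n \<Rightarrow> complex ^ 'n"
  assume "g \<in> {g. Vector_Spaces.linear (*s) (*s) g \<and> (\<forall>i\<in>P. g ` V i \<subseteq> V i)}"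
  then show "g \<in> {g. \<exists>c. g = (\<lambda>x. c *s x)}"
    using assms(2) by blast
next
  fix g :: "complex ^ 'n \<Rightarrow> complex ^ 'n"
  assume "g \<in> {g. \<exists>c. g = (\<lambda>x. c *s x)}"
  then obtain c where g: "g = (\<lambda>x. c *s x)" by blast
  have "Vector_Spaces.linear (*s) (*s) g"
    unfolding g by (rule vec.linear_scale_self)
  moreover have "g ` V i \<subseteq> V i" if "i \<in> P" for i
    using assms(1)[OF that] unfolding g by (auto intro: vec.subspace_scale)
  ultimately show "g \<in> {g. Vector_Spaces.linear (*s) (*s) g \<and> (\<forall>i\<in>P. g ` V i \<subseteq> V i)}"
    by blast
qed

lemma not_rep_equivalent_if_schurian_off:
  fixes V :: "complex \<Rightarrow> nat \<Rightarrow> (complex ^ 'n) set"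
  assumes sch: "schurian (P - {a}) (V l)" and inj_a: "inj (\<lambda>l. V l a)" and "l \<noteq> m"
    and "a \<in> P" and off_a: "\<And>i. i \<in> P - {a} \<Longrightarrow> V m i = V l i"
    and subspace_a: "vec.subspace (V l a)"
  shows "\<not> rep_equivalent P (V l) (V m)"
proof
  assume "rep_equivalent P (V l) (V m)"
  then obtain g where lin: "Vector_Spaces.linear (*s) (*s) g" and "bij g"
    and img: "\<forall>i\<in>P. g ` V l i = V m i"
    unfolding rep_equivalent_def by blast
  have "\<forall>i\<in>P - {a}. g ` V l i \<subseteq> V l i"
    using img off_a by auto
  with lin sch obtain c where g: "g = (\<lambda>x. c *s x)"
    unfolding schurian_def by blast
  have "c \<noteq> 0"
  proof
    assume "c = 0"
    then have "g 0 = g (axis undefined 1)" by (simp add: g)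
    then show False
      using \<open>bij g\<close> by (auto simp: bij_def inj_eq)
  qed
  then have "V m a = V l a"
    using img \<open>a \<in> P\<close> scale_image_subspace[OF _ subspace_a] by (auto simp: g)
  with inj_a \<open>l \<noteq> m\<close> show False
    by (auto dest: injD)
qed

lemma schurian_V1111: "schurian (P1111 - {a1111}) (V1111 l)"
proof (rule schurianI)
  show "vec.subspace (V1111 l i)" if "i \<in> P1111 - {a1111}" for i
    using that by (auto simp: P1111_def a1111_def V1111_def subspace_cspan)
next
  fix g :: "complex ^ 2 \<Rightarrow> complex ^ 2"
  assume lin: "Vector_Spaces.linear (*s) (*s) g"
    and inv: "\<And>i v. i \<in> P1111 - {a1111} \<Longrightarrow> v \<in> V1111 l i \<Longrightarrow> g v \<in> V1111 l i"
  have "g (ee 1) \<in> cspan {ee 1}" "g (ee 2) \<in> cspan {ee 2}"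
    "g (ee 1 + ee 2) \<in> cspan {ee 1 + ee 2}"
    using inv[of 1 "ee 1"] inv[of 2 "ee 2"] inv[of 3 "ee 1 + ee 2"]
    by (simp_all add: P1111_def a1111_def V1111_def cspan_base)
  note mem = this[unfolded mem_cspan_iff]
  obtain p1 where e1: "g (ee 1) = p1 *s ee 1" using mem(1) by auto
  obtain p2 where e2: "g (ee 2) = p2 *s ee 2" using mem(2) by auto
  obtain r where "g (ee 1 + ee 2) = r *s (ee 1 + ee 2)" using mem(3) by auto
  then have "p1 = r" "p2 = r"
    unfolding vec.linear_add[OF lin] e1 e2 by (auto simp: ee_coordinate_simps)
  with e1 e2 have "\<forall>i. g (axis i 1) = r *s axis i 1"
    by (simp add: all_of_nat_lessThan_CARD lessThan_nat_numeral ee_def)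
  then show "\<exists>c. g = (\<lambda>x. c *s x)"
    using linear_eq_scale_if_axis_eigenvectors[OF lin] by blast
qed

lemma schurian_V222: "schurian (P222 - {a222}) (V222 l)"
proof (rule schurianI)
  show "vec.subspace (V222 l i)" if "i \<in> P222 - {a222}" for i
    using that by (auto simp: P222_def a222_def V222_def subspace_cspan)
next
  fix g :: "complex ^ 3 \<Rightarrow> complex ^ 3"
  assume lin: "Vector_Spaces.linear (*s) (*s) g"
    and inv: "\<And>i v. i \<in> P222 - {a222} \<Longrightarrow> v \<in> V222 l i \<Longrightarrow> g v \<in> V222 l i"
  have "g (ee 1) \<in> cspan {ee 1}" "g (ee 3) \<in> cspan {ee 3}"
    "g (ee 2) \<in> cspan {ee 1, ee 2}" "g (ee 2) \<in> cspan {ee 2, ee 3}"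
    "g (ee 1 + ee 2 + ee 3) \<in> cspan {ee 1 + ee 2 + ee 3}"
    using inv[of 3 "ee 1"] inv[of 5 "ee 3"] inv[of 4 "ee 2"] inv[of 6 "ee 2"]
      inv[of 1 "ee 1 + ee 2 + ee 3"]
    by (simp_all add: P222_def a222_def V222_def cspan_base)
  note mem = this[unfolded mem_cspan_iff]
  obtain p1 where e1: "g (ee 1) = p1 *s ee 1" using mem(1) by auto
  obtain p3 where e3: "g (ee 3) = p3 *s ee 3" using mem(2) by auto
  obtain p2 where e2: "g (ee 2) = p2 *s ee 2"
  proof -
    obtain a b where "g (ee 2) = a *s ee 1 + b *s ee 2" using mem(3) by auto
    moreover obtain c d where "g (ee 2) = c *s ee 2 + d *s ee 3" using mem(4) by auto
    ultimately have "g (ee 2) = b *s ee 2" by (auto simp: ee_coordinate_simps)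
    then show thesis by (rule that)
  qed
  obtain r where "g (ee 1 + ee 2 + ee 3) = r *s (ee 1 + ee 2 + ee 3)" using mem(5) by auto
  then have "p1 = r" "p2 = r" "p3 = r"
    unfolding vec.linear_add[OF lin] e1 e2 e3 by (auto simp: ee_coordinate_simps)
  with e1 e2 e3 have "\<forall>i. g (axis i 1) = r *s axis i 1"
    by (simp add: all_of_nat_lessThan_CARD lessThan_nat_numeral ee_def)
  then show "\<exists>c. g = (\<lambda>x. c *s x)"
    using linear_eq_scale_if_axis_eigenvectors[OF lin] by blast
qed

lemma schurian_V133: "schurian (P133 - {a133}) (V133 l)"
proof (rule schurianI)
  show "vec.subspace (V133 l i)" if "i \<in> P133 - {a133}" for i
    using that by (auto simp: P133_def a133_def V133_def subspace_cspan)
next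
  fix g :: "complex ^ 4 \<Rightarrow> complex ^ 4"
  assume lin: "Vector_Spaces.linear (*s) (*s) g"
    and inv: "\<And>i v. i \<in> P133 - {a133} \<Longrightarrow> v \<in> V133 l i \<Longrightarrow> g v \<in> V133 l i"
  have "g (ee 4) \<in> cspan {ee 4}" "g (ee 3) \<in> cspan {ee 3}"
    "g (ee 1) \<in> cspan {ee 1, ee 4}" "g (ee 1) \<in> cspan {ee 1, ee 2, ee 3}"
    "g (ee 2) \<in> cspan {ee 2, ee 3}"
    "g (ee 1 + ee 2 + ee 3) \<in> cspan {ee 1 + ee 2 + ee 3, ee 2 + ee 4}"
    "g (ee 2 + ee 4) \<in> cspan {ee 1 + ee 2 + ee 3, ee 2 + ee 4}"
    using inv[of 2 "ee 4"] inv[of 5 "ee 3"] inv[of 3 "ee 1"] inv[of 7 "ee 1"] inv[of 6 "ee 2"]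
      inv[of 1 "ee 1 + ee 2 + ee 3"] inv[of 1 "ee 2 + ee 4"]
    by (simp_all add: P133_def a133_def V133_def cspan_base)
  note mem = this[unfolded mem_cspan_iff]
  obtain p4 where e4: "g (ee 4) = p4 *s ee 4" using mem(1) by auto
  obtain p3 where e3: "g (ee 3) = p3 *s ee 3" using mem(2) by auto
  obtain p1 where e1: "g (ee 1) = p1 *s ee 1"
  proof -
    obtain a b where "g (ee 1) = a *s ee 1 + b *s ee 4" using mem(3) by auto
    moreover obtain c d e where "g (ee 1) = c *s ee 1 + (d *s ee 2 + e *s ee 3)" using mem(4) by auto
    ultimately have "g (ee 1) = a *s ee 1" by (auto simp: ee_coordinate_simps)
    then show thesis by (rule that)
  qed
  obtain p2 q2 where e2: "g (ee 2) = p2 *s ee 2 + q2 *s ee 3" using mem(5) by auto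
  obtain t u where "g (ee 2 + ee 4) = t *s (ee 1 + ee 2 + ee 3) + u *s (ee 2 + ee 4)"
    using mem(7) by auto
  then have "q2 = 0" "p4 = p2"
    unfolding vec.linear_add[OF lin] e2 e4 by (auto simp: ee_coordinate_simps)
  obtain r s where "g (ee 1 + ee 2 + ee 3) = r *s (ee 1 + ee 2 + ee 3) + s *s (ee 2 + ee 4)"
    using mem(6) by auto
  then have "p1 = p2" "p3 = p2"
    unfolding vec.linear_add[OF lin] e1 e2 e3 using \<open>q2 = 0\<close> by (auto simp: ee_coordinate_simps)
  with e1 e2 e3 e4 \<open>q2 = 0\<close> \<open>p4 = p2\<close> have "\<forall>i. g (axis i 1) = p2 *s axis i 1"
    by (simp add: all_of_nat_lessThan_CARD lessThan_nat_numeral ee_def)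
  then show "\<exists>c. g = (\<lambda>x. c *s x)"
    using linear_eq_scale_if_axis_eigenvectors[OF lin] by blast
qed

lemma schurian_V125: "schurian (P125 - {a125}) (V125 l)"
proof (rule schurianI)
  show "vec.subspace (V125 l i)" if "i \<in> P125 - {a125}" for i
    using that by (auto simp: P125_def a125_def V125_def subspace_cspan)
next
  fix g :: "complex ^ 6 \<Rightarrow> complex ^ 6"
  assume lin: "Vector_Spaces.linear (*s) (*s) g"
    and inv: "\<And>i v. i \<in> P125 - {a125} \<Longrightarrow> v \<in> V125 l i \<Longrightarrow> g v \<in> V125 l i"
  have "g (ee 4) \<in> cspan {ee 4}" "g (ee 3) \<in> cspan {ee 3, ee 4}"
    "g (ee 2) \<in> cspan {ee 2, ee 3, ee 4}" "g (ee 2) \<in> cspan {ee 1, ee 2, ee 5, ee 6}"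
    "g (ee 1) \<in> cspan {ee 1, ee 2, ee 3, ee 4}" "g (ee 1) \<in> cspan {ee 1, ee 2, ee 5, ee 6}"
    "g (ee 5) \<in> cspan {ee 5, ee 6}" "g (ee 6) \<in> cspan {ee 5, ee 6}"
    "g (ee 1 + ee 2 + ee 3) \<in> cspan {ee 1 + ee 2 + ee 3, ee 2 + ee 4 + ee 5, ee 1 + ee 6}"
    "g (ee 2 + ee 4 + ee 5) \<in> cspan {ee 1 + ee 2 + ee 3, ee 2 + ee 4 + ee 5, ee 1 + ee 6}"
    "g (ee 1 + ee 6) \<in> cspan {ee 1 + ee 2 + ee 3, ee 2 + ee 4 + ee 5, ee 1 + ee 6}"
    using inv[of 4 "ee 4"] inv[of 5 "ee 3"] inv[of 6 "ee 2"] inv[of 3 "ee 2"] inv[of 7 "ee 1"]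
      inv[of 3 "ee 1"] inv[of 2 "ee 5"] inv[of 2 "ee 6"] inv[of 1 "ee 1 + ee 2 + ee 3"]
      inv[of 1 "ee 2 + ee 4 + ee 5"] inv[of 1 "ee 1 + ee 6"]
    by (simp_all add: P125_def a125_def V125_def cspan_base)
  note mem = this[unfolded mem_cspan_iff]
  obtain p4 where e4: "g (ee 4) = p4 *s ee 4" using mem(1) by auto
  obtain p3 q3 where e3: "g (ee 3) = p3 *s ee 3 + q3 *s ee 4" using mem(2) by auto
  obtain p2 where e2: "g (ee 2) = p2 *s ee 2"
  proof -
    obtain a b c where "g (ee 2) = a *s ee 2 + (b *s ee 3 + c *s ee 4)" using mem(3) by auto
    moreover obtain d e f h where "g (ee 2) = d *s ee 1 + (e *s ee 2 + (f *s ee 5 + h *s ee 6))"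
      using mem(4) by auto
    ultimately have "g (ee 2) = a *s ee 2" by (auto simp: ee_coordinate_simps)
    then show thesis by (rule that)
  qed
  obtain p1 q1 where e1: "g (ee 1) = p1 *s ee 1 + q1 *s ee 2"
  proof -
    obtain a b c d where "g (ee 1) = a *s ee 1 + (b *s ee 2 + (c *s ee 3 + d *s ee 4))"
      using mem(5) by auto
    moreover obtain e f h k where "g (ee 1) = e *s ee 1 + (f *s ee 2 + (h *s ee 5 + k *s ee 6))"
      using mem(6) by auto
    ultimately have "g (ee 1) = a *s ee 1 + b *s ee 2" by (auto simp: ee_coordinate_simps)
    then show thesis by (rule that)
  qed
  obtain p5 q5 where e5: "g (ee 5) = p5 *s ee 5 + q5 *s ee 6" using mem(7) by auto
  obtain q6 p6 where e6: "g (ee 6) = q6 *s ee 5 + p6 *s ee 6" using mem(8) by auto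
  obtain x y z where "g (ee 1 + ee 2 + ee 3)
      = x *s (ee 1 + ee 2 + ee 3) + (y *s (ee 2 + ee 4 + ee 5) + z *s (ee 1 + ee 6))"
    using mem(9) by auto
  then have "q3 = 0" "p3 = p1" "p2 = p1 - q1"
    unfolding vec.linear_add[OF lin] e1 e2 e3 by (auto simp: ee_coordinate_simps)
  obtain x y z where "g (ee 2 + ee 4 + ee 5)
      = x *s (ee 1 + ee 2 + ee 3) + (y *s (ee 2 + ee 4 + ee 5) + z *s (ee 1 + ee 6))"
    using mem(10) by auto
  then have "q5 = 0" "p4 = p2" "p5 = p2"
    unfolding vec.linear_add[OF lin] e2 e4 e5 by (auto simp: ee_coordinate_simps)
  obtain x y z where "g (ee 1 + ee 6)
      = x *s (ee 1 + ee 2 + ee 3) + (y *s (ee 2 + ee 4 + ee 5) + z *s (ee 1 + ee 6))"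
    using mem(11) by auto
  then have "q1 = 0" "q6 = 0" "p6 = p1"
    unfolding vec.linear_add[OF lin] e1 e6 by (auto simp: ee_coordinate_simps)
  with e1 e2 e3 e4 e5 e6 \<open>q3 = 0\<close> \<open>p3 = p1\<close> \<open>p2 = p1 - q1\<close> \<open>q5 = 0\<close> \<open>p4 = p2\<close> \<open>p5 = p2\<close>
  have "\<forall>i. g (axis i 1) = p1 *s axis i 1"
    by (simp add: all_of_nat_lessThan_CARD lessThan_nat_numeral ee_def)
  then show "\<exists>c. g = (\<lambda>x. c *s x)"
    using linear_eq_scale_if_axis_eigenvectors[OF lin] by blast
qed

lemma schurian_VN4: "schurian (PN4 - {aN4}) (VN4 l)"
proof (rule schurianI)
  show "vec.subspace (VN4 l i)" if "i \<in> PN4 - {aN4}" for i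
    using that by (auto simp: PN4_def aN4_def VN4_def subspace_cspan)
next
  fix g :: "complex ^ 5 \<Rightarrow> complex ^ 5"
  assume lin: "Vector_Spaces.linear (*s) (*s) g"
    and inv: "\<And>i v. i \<in> PN4 - {aN4} \<Longrightarrow> v \<in> VN4 l i \<Longrightarrow> g v \<in> VN4 l i"
  have "g (ee 4) \<in> cspan {ee 4}" "g (ee 3) \<in> cspan {ee 3, ee 4}"
    "g (ee 2) \<in> cspan {ee 2, ee 3, ee 4}" "g (ee 2) \<in> cspan {ee 1, ee 2, ee 5}"
    "g (ee 1) \<in> cspan {ee 1, ee 2, ee 3, ee 4}" "g (ee 1) \<in> cspan {ee 1, ee 2, ee 5}"
    "g (ee 5) \<in> cspan {ee 5}"
    "g (ee 2 + ee 3 + ee 5) \<in> cspan {ee 2 + ee 3 + ee 5, ee 1 + ee 3 + ee 4}"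
    "g (ee 1 + ee 3 + ee 4) \<in> cspan {ee 2 + ee 3 + ee 5, ee 1 + ee 3 + ee 4}"
    using inv[of 1 "ee 4"] inv[of 2 "ee 3"] inv[of 3 "ee 2"] inv[of 8 "ee 2"] inv[of 4 "ee 1"]
      inv[of 8 "ee 1"] inv[of 6 "ee 5"] inv[of 5 "ee 2 + ee 3 + ee 5"] inv[of 5 "ee 1 + ee 3 + ee 4"]
    by (simp_all add: PN4_def aN4_def VN4_def cspan_base)
  note mem = this[unfolded mem_cspan_iff]
  obtain p4 where e4: "g (ee 4) = p4 *s ee 4" using mem(1) by auto
  obtain p3 q3 where e3: "g (ee 3) = p3 *s ee 3 + q3 *s ee 4" using mem(2) by auto
  obtain p5 where e5: "g (ee 5) = p5 *s ee 5" using mem(7) by auto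
  obtain p2 where e2: "g (ee 2) = p2 *s ee 2"
  proof -
    obtain a b c where "g (ee 2) = a *s ee 2 + (b *s ee 3 + c *s ee 4)" using mem(3) by auto
    moreover obtain d e f where "g (ee 2) = d *s ee 1 + (e *s ee 2 + f *s ee 5)" using mem(4) by auto
    ultimately have "g (ee 2) = a *s ee 2" by (auto simp: ee_coordinate_simps)
    then show thesis by (rule that)
  qed
  obtain p1 q1 where e1: "g (ee 1) = p1 *s ee 1 + q1 *s ee 2"
  proof -
    obtain a b c d where "g (ee 1) = a *s ee 1 + (b *s ee 2 + (c *s ee 3 + d *s ee 4))"
      using mem(5) by auto
    moreover obtain e f h where "g (ee 1) = e *s ee 1 + (f *s ee 2 + h *s ee 5)" using mem(6) by auto
    ultimately have "g (ee 1) = a *s ee 1 + b *s ee 2" by (auto simp: ee_coordinate_simps)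
    then show thesis by (rule that)
  qed
  obtain r s where "g (ee 2 + ee 3 + ee 5) = r *s (ee 2 + ee 3 + ee 5) + s *s (ee 1 + ee 3 + ee 4)"
    using mem(8) by auto
  then have "q3 = 0" "p2 = p3" "p5 = p3"
    unfolding vec.linear_add[OF lin] e2 e3 e5 by (auto simp: ee_coordinate_simps)
  obtain t u where "g (ee 1 + ee 3 + ee 4) = t *s (ee 2 + ee 3 + ee 5) + u *s (ee 1 + ee 3 + ee 4)"
    using mem(9) by auto
  then have "q1 = 0" "p1 = p3" "p4 = p3"
    unfolding vec.linear_add[OF lin] e1 e3 e4 using \<open>q3 = 0\<close> by (auto simp: ee_coordinate_simps)
  with e1 e2 e3 e4 e5 \<open>q3 = 0\<close> \<open>p2 = p3\<close> \<open>p5 = p3\<close> have "\<forall>i. g (axis i 1) = p3 *s axis i 1"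
    by (simp add: all_of_nat_lessThan_CARD lessThan_nat_numeral ee_def)
  then show "\<exists>c. g = (\<lambda>x. c *s x)"
    using linear_eq_scale_if_axis_eigenvectors[OF lin] by blast
qed

lemma inj_V1111_at_a: "inj (\<lambda>l. V1111 l a1111)"
proof (rule injI)
  fix l m
  have "ee 1 + l *s ee 2 \<in> V1111 l a1111"
    by (simp add: V1111_def a1111_def cspan_base)
  moreover assume "V1111 l a1111 = V1111 m a1111"
  ultimately have "ee 1 + l *s ee 2 \<in> V1111 m a1111"
    by simp
  then show "l = m"
    by (auto simp: V1111_def a1111_def mem_cspan_iff ee_coordinate_simps)
qed

lemma inj_V222_at_a: "inj (\<lambda>l. V222 l a222)"
proof (rule injI)
  fix l m
  have "ee 1 + l *s ee 3 \<in> V222 l a222"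
    by (simp add: V222_def a222_def cspan_base)
  moreover assume "V222 l a222 = V222 m a222"
  ultimately have "ee 1 + l *s ee 3 \<in> V222 m a222"
    by simp
  then show "l = m"
    by (auto simp: V222_def a222_def mem_cspan_iff ee_coordinate_simps)
qed

lemma inj_V133_at_a: "inj (\<lambda>l. V133 l a133)"
proof (rule injI)
  fix l m
  have "ee 2 + l *s ee 3 \<in> V133 l a133"
    by (simp add: V133_def a133_def cspan_base)
  moreover assume "V133 l a133 = V133 m a133"
  ultimately have "ee 2 + l *s ee 3 \<in> V133 m a133"
    by simp
  then show "l = m"
    by (auto simp: V133_def a133_def mem_cspan_iff ee_coordinate_simps)
qed

lemma inj_V125_at_a: "inj (\<lambda>l. V125 l a125)"
proof (rule injI)
  fix l m
  have "ee 5 + l *s ee 6 \<in> V125 l a125"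
    by (simp add: V125_def a125_def cspan_base)
  moreover assume "V125 l a125 = V125 m a125"
  ultimately have "ee 5 + l *s ee 6 \<in> V125 m a125"
    by simp
  then show "l = m"
    by (auto simp: V125_def a125_def mem_cspan_iff ee_coordinate_simps)
qed

lemma inj_VN4_at_a: "inj (\<lambda>l. VN4 l aN4)"
proof (rule injI)
  fix l m
  have "ee 3 + l *s ee 4 \<in> VN4 l aN4"
    by (simp add: VN4_def aN4_def cspan_base)
  moreover assume "VN4 l aN4 = VN4 m aN4"
  ultimately have "ee 3 + l *s ee 4 \<in> VN4 m aN4"
    by simp
  then show "l = m"
    by (auto simp: VN4_def aN4_def mem_cspan_iff ee_coordinate_simps)
qed

theorem proposition1:
  shows "(\<forall>l m. l \<noteq> m \<longrightarrow> \<not> rep_equivalent P1111 (V1111 l) (V1111 m))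
       \<and> (\<forall>l m. l \<noteq> m \<longrightarrow> \<not> rep_equivalent P222 (V222 l) (V222 m))
       \<and> (\<forall>l m. l \<noteq> m \<longrightarrow> \<not> rep_equivalent P133 (V133 l) (V133 m))
       \<and> (\<forall>l m. l \<noteq> m \<longrightarrow> \<not> rep_equivalent P125 (V125 l) (V125 m))
       \<and> (\<forall>l m. l \<noteq> m \<longrightarrow> \<not> rep_equivalent PN4 (VN4 l) (VN4 m))
       \<and> (\<forall>l. schurian (P1111 - {a1111}) (V1111 l))
       \<and> (\<forall>l. schurian (P222 - {a222}) (V222 l))
       \<and> (\<forall>l. schurian (P133 - {a133}) (V133 l))
       \<and> (\<forall>l. schurian (P125 - {a125}) (V125 l))
       \<and> (\<forall>l. schurian (PN4 - {aN4}) (VN4 l))"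
proof -
  have "\<not> rep_equivalent P1111 (V1111 l) (V1111 m)" if "l \<noteq> m" for l m
    by (rule not_rep_equivalent_if_schurian_off[OF schurian_V1111 inj_V1111_at_a that])
      (auto simp: P1111_def a1111_def V1111_def subspace_cspan)
  moreover have "\<not> rep_equivalent P222 (V222 l) (V222 m)" if "l \<noteq> m" for l m
    by (rule not_rep_equivalent_if_schurian_off[OF schurian_V222 inj_V222_at_a that])
      (auto simp: P222_def a222_def V222_def subspace_cspan)
  moreover have "\<not> rep_equivalent P133 (V133 l) (V133 m)" if "l \<noteq> m" for l m
    by (rule not_rep_equivalent_if_schurian_off[OF schurian_V133 inj_V133_at_a that])
      (auto simp: P133_def a133_def V133_def subspace_cspan)
  moreover have "\<not> rep_equivalent P125 (V125 l) (V125 m)" if "l \<noteq> m" for l m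
    by (rule not_rep_equivalent_if_schurian_off[OF schurian_V125 inj_V125_at_a that])
      (auto simp: P125_def a125_def V125_def subspace_cspan)
  moreover have "\<not> rep_equivalent PN4 (VN4 l) (VN4 m)" if "l \<noteq> m" for l m
    by (rule not_rep_equivalent_if_schurian_off[OF schurian_VN4 inj_VN4_at_a that])
      (auto simp: PN4_def aN4_def VN4_def subspace_cspan)
  ultimately show ?thesis
    using schurian_V1111 schurian_V222 schurian_V133 schurian_V125 schurian_VN4 by blast
qed

end
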